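(* For the ladder graph $G=P_k\,\square\,P_2$ with $k\ge 4$, $\bar{\gamma}_p(G)=\left\lceil\frac{k-4}{3}\right\rceil$.
   Context: $P_k$ is the path on $k$ vertices. The Cartesian product $G\,\square\,H$ has vertex set $V(G)\times V(H)$, with $(u_1,v_1)$ adjacent to $(u_2,v_2)$ iff either $u_1=u_2$ and $\{v_1,v_2\}\in E(H)$, or $\{u_1,u_2\}\in E(G)$ and $v_1=v_2$. For $v\in V$, $N[v]$ is the closed neighborhood; for $S\subseteq V$, $N[S]=\bigcup_{v\in S}N[v]$. Define $\mathcal{P}^0(S)=N[S]$, $\mathcal{P}^{i+1}(S)=\mathcal{P}^i(S)\cup\{w : \{w\}=N[v]\setminus\mathcal{P}^i(S)\text{ for some } v\in\mathcal{P}^i(S)\}$, with eventual value $\mathcal{P}^\infty(S)$. $S$ is a power dominating set (PDS) if $\mathcal{P}^\infty(S)=V$, and a failed power dominating set (FPDS) otherwise. $\bar{\gamma}_p(G)$ is the maximum cardinality of an FPDS of $G$. *)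

theory Defs
  imports Complex_Main
begin

(* A simple graph is its vertex set together with a set of two-element edges. *)
type_synonym 'a graph = "'a set \<times> 'a set set"

abbreviation verts :: "'a graph \<Rightarrow> 'a set" where
  "verts \<equiv> fst"

abbreviation edges :: "'a graph \<Rightarrow> 'a set set" where
  "edges \<equiv> snd"

definition path_graph :: "nat \<Rightarrow> nat graph" where
  "path_graph k = ({..<k}, {{i, Suc i} | i. Suc i < k})"

definition cartesian_product :: "'a graph \<Rightarrow> 'b graph \<Rightarrow> ('a \<times> 'b) graph" where
  "cartesian_product G H =
     (verts G \<times> verts H,
      {{(u1, v1), (u2, v2)} | u1 v1 u2 v2.
         {(u1, v1), (u2, v2)} \<subseteq> verts G \<times> verts H \<and>
         (u1 = u2 \<and> {v1, v2} \<in> edges H \<or> {u1, u2} \<in> edges G \<and> v1 = v2)})"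

definition closed_nbhd :: "'a graph \<Rightarrow> 'a \<Rightarrow> 'a set" where
  "closed_nbhd G v = insert v {w. {v, w} \<in> edges G}"

definition closed_nbhd_set :: "'a graph \<Rightarrow> 'a set \<Rightarrow> 'a set" where
  "closed_nbhd_set G S = (\<Union>v\<in>S. closed_nbhd G v)"

primrec observed :: "'a graph \<Rightarrow> 'a set \<Rightarrow> nat \<Rightarrow> 'a set" where
  "observed G S 0 = closed_nbhd_set G S"
| "observed G S (Suc i) = observed G S i \<union>
     {w. \<exists>v \<in> observed G S i. {w} = closed_nbhd G v - observed G S i}"

(* The sequence of observed sets is increasing, so on a finite graph its
   eventual value is the union. *)
definition observed_eventually :: "'a graph \<Rightarrow> 'a set \<Rightarrow> 'a set" where
  "observed_eventually G S = (\<Union>i. observed G S i)"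

definition power_dominating :: "'a graph \<Rightarrow> 'a set \<Rightarrow> bool" where
  "power_dominating G S \<longleftrightarrow> S \<subseteq> verts G \<and> observed_eventually G S = verts G"

definition failed_power_dominating :: "'a graph \<Rightarrow> 'a set \<Rightarrow> bool" where
  "failed_power_dominating G S \<longleftrightarrow> S \<subseteq> verts G \<and> \<not> power_dominating G S"

(* Max is meaningful for finite graphs with at least one vertex, where the
   empty set is always a failed power dominating set. *)
definition failed_power_domination_number :: "'a graph \<Rightarrow> nat" where
  "failed_power_domination_number G = Max {card S | S. failed_power_dominating G S}"

end

theory Submission
  imports Defs
begin

text \<open>
  Two adjacent fully observed columns of a ladder force the whole ladder, in both directions. Hence
  in a failed power dominating set no vertex lies in the two outermost columns at either end, and any
  two vertices are at least three columns apart. Conversely, vertices placed in columns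
  \<open>2, 5, 8, \<dots>\<close> in alternating rows have a closed neighbourhood in which every
  observed vertex misses either none or two of its neighbours, so that no forcing takes place.
\<close>

section \<open>The eventually observed set as a closure, in an arbitrary graph\<close>

text \<open>With finite neighbourhoods, \<open>observed_eventually G S\<close> is the least such set
  containing the closed neighbourhood of \<open>S\<close>; the ladder arguments can therefore ignore
  the individual stages.\<close>

definition forcing_closed :: "'a graph \<Rightarrow> 'a set \<Rightarrow> bool" where
  "forcing_closed G T \<longleftrightarrow>
     (\<forall>v\<in>T. \<forall>w\<in>closed_nbhd G v. closed_nbhd G v - {w} \<subseteq> T \<longrightarrow> w \<in> T)"

lemma forcing_closedD:
  assumes "forcing_closed G T" "v \<in> T" "w \<in> closed_nbhd G v" "closed_nbhd G v - {w} \<subseteq> T"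
  shows "w \<in> T"
  using assms unfolding forcing_closed_def by blast

lemma mono_observed: "mono (observed G S)"
  by (intro mono_iff_le_Suc[THEN iffD2]) auto

text \<open>The stages form a chain, so the finite set consisting of \<open>v\<close> and its
  neighbours other than \<open>w\<close> already lies in one stage; the next stage contains
  \<open>w\<close>.\<close>

lemma forcing_closed_observed_eventually:
  assumes "\<And>v. finite (closed_nbhd G v)"
  shows "forcing_closed G (observed_eventually G S)"
  unfolding forcing_closed_def
proof (intro ballI impI)
  fix v w
  let ?T = "observed_eventually G S" and ?N = "closed_nbhd G v"
  assume v: "v \<in> ?T" and w: "w \<in> ?N" and sub: "?N - {w} \<subseteq> ?T"
  have "finite (insert v (?N - {w}))" "insert v (?N - {w}) \<subseteq> (\<Union>i. observed G S i)"
    using assms v sub by (auto simp: observed_eventually_def)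
  moreover have "subset.chain UNIV (range (observed G S))"
    unfolding subset_chain_def
  proof (intro conjI ballI)
    fix X Y assume "X \<in> range (observed G S)" "Y \<in> range (observed G S)"
    then obtain i j where "X = observed G S i" "Y = observed G S j" by blast
    then show "X \<subseteq> Y \<or> Y \<subseteq> X"
      using monoD[OF mono_observed[of G S]] by (cases "i \<le> j") simp_all
  qed simp
  ultimately obtain B where "B \<in> range (observed G S)" "insert v (?N - {w}) \<subseteq> B"
    using finite_subset_Union_chain[of _ "range (observed G S)"] by blast
  then obtain i where i: "v \<in> observed G S i" "?N - {w} \<subseteq> observed G S i" by auto
  have "w \<in> observed G S (Suc i)"
  proof (cases "w \<in> observed G S i")
    case False
    then have "{w} = ?N - observed G S i" using i w by auto
    then show ?thesis using i by auto
  qed simp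
  then show "w \<in> ?T" unfolding observed_eventually_def by blast
qed

lemma closed_nbhd_set_subset_observed_eventually:
  "closed_nbhd_set G S \<subseteq> observed_eventually G S"
  unfolding observed_eventually_def by (metis UN_upper UNIV_I observed.simps(1))

text \<open>Minimality, by induction on the stage: a newly forced vertex is the only one of
  \<open>closed_nbhd G v\<close> that can lie outside \<open>T\<close>, hence it lies in
  \<open>T\<close>.\<close>

lemma observed_eventually_subset:
  assumes "closed_nbhd_set G S \<subseteq> T" "forcing_closed G T"
  shows "observed_eventually G S \<subseteq> T"
proof -
  have "observed G S i \<subseteq> T" for i
  proof (induction i)
    case 0
    then show ?case using assms by simp
  next
    case (Suc i)
    have "w \<in> T" if "v \<in> observed G S i" "{w} = closed_nbhd G v - observed G S i" for v w
      by (rule forcing_closedD[OF assms(2), of v]) (use that Suc in auto)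
    then show ?case using Suc by auto
  qed
  then show ?thesis unfolding observed_eventually_def by blast
qed

lemma failed_power_domination_number_eqI:
  assumes "finite (verts G)" "failed_power_dominating G S" "card S = n"
    and "\<And>S. failed_power_dominating G S \<Longrightarrow> card S \<le> n"
  shows "failed_power_domination_number G = n"
proof -
  have "finite {S. failed_power_dominating G S}"
    using assms(1) by (rule finite_subset[rotated, OF finite_Pow_iff[THEN iffD2]])
      (auto simp: failed_power_dominating_def)
  then show ?thesis
    unfolding failed_power_domination_number_def using assms(2-) by (intro Max_eqI) auto
qed

section \<open>Neighbourhoods in the ladder and propagation along its columns\<close>

abbreviation ladder :: "nat \<Rightarrow> (nat \<times> nat) graph" where
  "ladder k \<equiv> cartesian_product (path_graph k) (path_graph 2)"

lemma verts_ladder: "verts (ladder k) = {..<k} \<times> {..<2}"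
  by (simp add: cartesian_product_def path_graph_def)

lemma edges_path_graph_iff:
  "{i, j} \<in> edges (path_graph k) \<longleftrightarrow> (j = Suc i \<and> j < k) \<or> (i = Suc j \<and> i < k)"
  by (auto simp: path_graph_def doubleton_eq_iff)

lemma edges_cartesian_product_iff:
  "{(a, b), (c, d)} \<in> edges (cartesian_product G H) \<longleftrightarrow>
     a \<in> verts G \<and> c \<in> verts G \<and> b \<in> verts H \<and> d \<in> verts H \<and>
     (a = c \<and> {b, d} \<in> edges H \<or> {a, c} \<in> edges G \<and> b = d)" (is "?l \<longleftrightarrow> ?r")
proof
  assume ?l
  then obtain u1 v1 u2 v2 where *: "{(a, b), (c, d)} = {(u1, v1), (u2, v2)}"
    "{(u1, v1), (u2, v2)} \<subseteq> verts G \<times> verts H"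
    "u1 = u2 \<and> {v1, v2} \<in> edges H \<or> {u1, u2} \<in> edges G \<and> v1 = v2"
    unfolding cartesian_product_def by auto
  then show ?r by (auto simp: doubleton_eq_iff insert_commute)
qed (auto simp: cartesian_product_def)

text \<open>The first disjunct carries no bounds because \<open>closed_nbhd\<close> contains its
  centre even off the graph. With rows below 2, \<open>d \<noteq> b\<close> describes the rung
  neighbour.\<close>

lemma mem_closed_nbhd_ladder_iff:
  "(c, d) \<in> closed_nbhd (ladder k) (a, b) \<longleftrightarrow>
     c = a \<and> d = b \<or>
     a < k \<and> c < k \<and> b < 2 \<and> d < 2 \<and> (c = a \<and> d \<noteq> b \<or> d = b \<and> (c = Suc a \<or> a = Suc c))"
proof -
  have "verts (path_graph n) = {..<n}" for n by (simp add: path_graph_def)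
  then show ?thesis
    unfolding closed_nbhd_def
    by (auto simp: edges_cartesian_product_iff edges_path_graph_iff)
qed

lemma finite_closed_nbhd_ladder: "finite (closed_nbhd (ladder k) v)"
proof (rule finite_subset)
  show "closed_nbhd (ladder k) v \<subseteq> insert v ({..<k} \<times> {..<2})"
    by (cases v) (auto simp: mem_closed_nbhd_ladder_iff)
qed simp

text \<open>The rung neighbour and the left neighbour of \<open>(c, b)\<close>, if there is one, lie
  in \<open>T\<close>, so only the right neighbour is left to be forced.\<close>

lemma ladder_force_right:
  assumes "forcing_closed (ladder k) T" "Suc c < k" "\<forall>b<2. (c, b) \<in> T"
    and "0 < c \<Longrightarrow> \<forall>b<2. (c - 1, b) \<in> T"
  shows "\<forall>b<2. (Suc c, b) \<in> T"
proof (intro allI impI)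
  fix b :: nat assume b: "b < 2"
  show "(Suc c, b) \<in> T"
    by (rule forcing_closedD[OF assms(1), of "(c, b)"])
      (use assms(2-) b in \<open>auto simp: mem_closed_nbhd_ladder_iff\<close>)
qed

lemma ladder_force_left:
  assumes "forcing_closed (ladder k) T" "Suc c < k" "\<forall>b<2. (Suc c, b) \<in> T"
    and "Suc (Suc c) < k \<Longrightarrow> \<forall>b<2. (Suc (Suc c), b) \<in> T"
  shows "\<forall>b<2. (c, b) \<in> T"
proof (intro allI impI)
  fix b :: nat assume b: "b < 2"
  show "(c, b) \<in> T"
    by (rule forcing_closedD[OF assms(1), of "(Suc c, b)"])
      (use assms(2-) b in \<open>auto simp: mem_closed_nbhd_ladder_iff\<close>)
qed

lemma ladder_full_columns:
  assumes "forcing_closed (ladder k) T" "Suc c < k"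
    and "\<forall>b<2. (c, b) \<in> T" "\<forall>b<2. (Suc c, b) \<in> T"
  shows "verts (ladder k) \<subseteq> T"
proof -
  \<comment> \<open>Pairs of adjacent columns are carried along, since a forcing step needs the
    column behind it to be full as well. The guard covers indices beyond the right end.\<close>
  have right: "Suc a < k \<longrightarrow> (\<forall>b<2. (a, b) \<in> T) \<and> (\<forall>b<2. (Suc a, b) \<in> T)" if "c \<le> a" for a
    using that
  proof (induction a rule: dec_induct)
    case (step n)
    then show ?case using ladder_force_right[OF assms(1), of "Suc n"] by auto
  qed (use assms in auto)
  have left: "(\<forall>b<2. (a, b) \<in> T) \<and> (\<forall>b<2. (Suc a, b) \<in> T)" if "a \<le> c" for a
    using that
  proof (induction a rule: inc_induct)
    case (step n)
    then show ?case using ladder_force_left[OF assms(1), of n] assms(2) by auto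
  qed (use assms in auto)
  have "(a, b) \<in> T" if "a < k" "b < 2" for a b
  proof (cases "a \<le> Suc c")
    case True
    then show ?thesis using left[of a] left[of c] that by (cases "a = Suc c") auto
  next
    case False
    then show ?thesis using right[of "a - 1"] that by auto
  qed
  then show ?thesis by (auto simp: verts_ladder)
qed

section \<open>Constraints on the columns of a failed set, and the upper bound\<close>

context
  fixes k :: nat and S T :: "(nat \<times> nat) set"
  assumes closed: "forcing_closed (ladder k) T"
    and nbhd: "closed_nbhd_set (ladder k) S \<subseteq> T"
    and S: "S \<subseteq> verts (ladder k)"
    and proper: "\<not> verts (ladder k) \<subseteq> T"
begin

lemma not_full_columns:
  assumes "Suc c < k" "\<forall>b<2. (c, b) \<in> T" "\<forall>b<2. (Suc c, b) \<in> T"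
  shows False
  using ladder_full_columns[OF closed assms] proper by blast

lemma bounds:
  assumes "(c, b) \<in> S"
  shows "c < k" "b < 2"
  using assms S by (auto simp: verts_ladder)

lemma column_full:
  assumes "(c, b) \<in> S"
  shows "\<forall>d<2. (c, d) \<in> T"
proof (intro allI impI)
  fix d :: nat assume "d < 2"
  then have "(c, d) \<in> closed_nbhd (ladder k) (c, b)"
    using bounds[OF assms] by (auto simp: mem_closed_nbhd_ladder_iff)
  then show "(c, d) \<in> T" using nbhd assms unfolding closed_nbhd_set_def by blast
qed

lemma row_nbr_observed:
  assumes "(c, b) \<in> S" "a < k" "a = Suc c \<or> c = Suc a"
  shows "(a, b) \<in> T"
proof -
  have "(a, b) \<in> closed_nbhd (ladder k) (c, b)"
    using bounds[OF assms(1)] assms by (auto simp: mem_closed_nbhd_ladder_iff)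
  then show ?thesis using nbhd assms unfolding closed_nbhd_set_def by blast
qed

lemma column_fullI:
  assumes "(a, b) \<in> T" "(a, 1 - b) \<in> T" "b < 2"
  shows "\<forall>d<2. (a, d) \<in> T"
proof (intro allI impI)
  fix d :: nat assume "d < 2"
  then have "d = b \<or> d = 1 - b" using assms by auto
  then show "(a, d) \<in> T" using assms by auto
qed

text \<open>With all row neighbours of \<open>(a, b)\<close> in \<open>T\<close>, its rung neighbour
  is the only one that may be missing. The guards allow for end columns.\<close>

lemma cross_force:
  assumes "(a, b) \<in> T" "a < k" "b < 2" "0 < a \<Longrightarrow> (a - 1, b) \<in> T" "Suc a < k \<Longrightarrow> (Suc a, b) \<in> T"
  shows "\<forall>d<2. (a, d) \<in> T"
proof -
  have "(a, 1 - b) \<in> T"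
    by (rule forcing_closedD[OF closed assms(1)])
      (use assms in \<open>auto simp: mem_closed_nbhd_ladder_iff\<close>)
  then show ?thesis using assms by (intro column_fullI[of a b])
qed

text \<open>A vertex in column 0 fills that column, which then forces column 1. A vertex in column 1
  fills column 1 and dominates one vertex of column 0, which forces the other. Both give two
  adjacent full columns.\<close>

lemma column_ge_2:
  assumes "(c, b) \<in> S" "4 \<le> k"
  shows "2 \<le> c"
proof (rule ccontr)
  note b = bounds[OF assms(1)]
  assume "\<not> 2 \<le> c"
  then consider "c = 0" | "c = 1" by linarith
  then show False
  proof cases
    case 1
    have "\<forall>d<2. (Suc 0, d) \<in> T"
      using ladder_force_right[OF closed, of 0] column_full[OF assms(1)] 1 assms(2) by simp
    then show False using not_full_columns[of 0] column_full[OF assms(1)] 1 assms(2) by simp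
  next
    case 2
    have "\<forall>d<2. (0, d) \<in> T"
      by (rule cross_force[of 0 b])
        (use row_nbr_observed[OF assms(1), of 0] column_full[OF assms(1)] b 2 in auto)
    then show False using not_full_columns[of 0] column_full[OF assms(1)] 2 assms(2) by simp
  qed
qed

lemma column_le:
  assumes "(c, b) \<in> S" "4 \<le> k"
  shows "c + 3 \<le> k"
proof (rule ccontr)
  note b = bounds[OF assms(1)]
  assume "\<not> c + 3 \<le> k"
  then consider "k = Suc c" | "k = Suc (Suc c)" using b by linarith
  then show False
  proof cases
    case 1
    then obtain a where a: "c = Suc a" using assms(2) by (cases c) auto
    have "\<forall>d<2. (a, d) \<in> T"
      using ladder_force_left[OF closed, of a] column_full[OF assms(1)] 1 a by simp
    then show False using not_full_columns[of a] column_full[OF assms(1)] 1 a by simp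
  next
    case 2
    have "\<forall>d<2. (Suc c, d) \<in> T"
      by (rule cross_force[of "Suc c" b])
        (use row_nbr_observed[OF assms(1), of "Suc c"] column_full[OF assms(1)] b 2 in auto)
    then show False using not_full_columns[of c] column_full[OF assms(1)] 2 by simp
  qed
qed

text \<open>Two vertices filling a column dominate the whole next column, which exists by
  \<open>column_le\<close>.\<close>

lemma same_column:
  assumes "(c, b) \<in> S" "(c, d) \<in> S" "4 \<le> k"
  shows "b = d"
proof (rule ccontr)
  assume "b \<noteq> d"
  then have d: "d = 1 - b" using bounds[OF assms(1)] bounds[OF assms(2)] by auto
  have c: "Suc c < k" using column_le[OF assms(1,3)] by simp
  have "\<forall>e<2. (Suc c, e) \<in> T"
    using row_nbr_observed[OF assms(1) c] row_nbr_observed[OF assms(2) c] bounds[OF assms(1)] d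
    by (intro column_fullI[of _ b]) auto
  then show False using not_full_columns[OF c column_full[OF assms(1)]] by simp
qed

text \<open>At distance 1 the two full columns are adjacent. At distance 2 the middle column is
  dominated entirely if the rows differ; if they agree, its dominated vertex has both row neighbours
  in full columns and forces across the rung.\<close>

lemma column_gap:
  assumes "(c, b) \<in> S" "(a, d) \<in> S" "c < a"
  shows "c + 3 \<le> a"
proof (rule ccontr)
  note b = bounds[OF assms(1)] bounds[OF assms(2)]
  assume "\<not> c + 3 \<le> a"
  then consider "a = Suc c" | "a = Suc (Suc c)" using assms(3) by linarith
  then show False
  proof cases
    case 1
    then show False
      using not_full_columns[of c] column_full[OF assms(1)] column_full[OF assms(2)] b by simp
  next
    case 2
    then have c: "Suc c < k" using b by simp
    have T: "(Suc c, b) \<in> T" "(Suc c, d) \<in> T"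
      using row_nbr_observed[OF assms(1) c] row_nbr_observed[OF assms(2) c] 2 by auto
    have "\<forall>e<2. (Suc c, e) \<in> T"
    proof (cases "b = d")
      case True
      then show ?thesis
        by (intro cross_force[of _ b])
          (use T c b 2 column_full[OF assms(1)] column_full[OF assms(2)] in auto)
    next
      case False
      then have "d = 1 - b" using b by auto
      then show ?thesis using T b by (intro column_fullI[of _ b]) auto
    qed
    then show False using not_full_columns[OF c column_full[OF assms(1)]] by simp
  qed
qed

lemma card_le:
  assumes "4 \<le> k"
  shows "card S \<le> (k - 2) div 3"
proof -
  \<comment> \<open>Blocks of three columns, starting at the first admissible column 2; each block
    holds at most one vertex of \<open>S\<close>.\<close>
  define f :: "nat \<times> nat \<Rightarrow> nat" where "f = (\<lambda>(c, b). (c - 2) div 3)"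
  have neq: "(c - 2) div 3 < (a - 2) div 3" if "(c, b) \<in> S" "(a, d) \<in> S" "c < a" for a b c d
    using column_gap[OF that] column_ge_2[OF that(1) assms] by linarith
  have "inj_on f S"
  proof (rule inj_onI)
    fix x y assume xy: "x \<in> S" "y \<in> S" "f x = f y"
    obtain c b a d where [simp]: "x = (c, b)" "y = (a, d)" by fastforce
    have "(c - 2) div 3 = (a - 2) div 3" using xy by (simp add: f_def)
    then have "c = a"
      using neq[of c b a d] neq[of a d c b] xy by (cases c a rule: linorder_cases) auto
    then show "x = y" using same_column[of c b d] xy assms by simp
  qed
  moreover have "f ` S \<subseteq> {..<(k - 2) div 3}"
  proof clarify
    fix c b assume cb: "(c, b) \<in> S"
    have "2 \<le> c" "c + 3 \<le> k" using column_ge_2[OF cb assms] column_le[OF cb assms] .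
    \<comment> \<open>Since \<open>c \<ge> 2\<close>, \<open>(c + 1) div 3\<close> is
      \<open>(c - 2) div 3 + 1\<close>, which turns the weak bound into a strict one.\<close>
    then show "f (c, b) < (k - 2) div 3" unfolding f_def using div_le_mono[of "c + 1" "k - 2" 3] by simp
  qed
  ultimately show ?thesis
    by (metis card_image card_lessThan card_mono finite_lessThan)
qed

end

lemma card_failed_power_dominating_ladder_le:
  assumes "4 \<le> k" "failed_power_dominating (ladder k) S"
  shows "card S \<le> (k - 2) div 3"
proof -
  let ?T = "observed_eventually (ladder k) S"
  have S: "S \<subseteq> verts (ladder k)" and ne: "?T \<noteq> verts (ladder k)"
    using assms(2) by (auto simp: failed_power_dominating_def power_dominating_def)
  \<comment> \<open>Observation never leaves the vertex set, so an observed set different from it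
    must miss a vertex.\<close>
  have "forcing_closed (ladder k) (verts (ladder k))"
    by (auto simp: forcing_closed_def verts_ladder mem_closed_nbhd_ladder_iff)
  moreover have "closed_nbhd_set (ladder k) S \<subseteq> verts (ladder k)"
    using S by (fastforce simp: closed_nbhd_set_def verts_ladder mem_closed_nbhd_ladder_iff)
  ultimately have "?T \<subseteq> verts (ladder k)" by (intro observed_eventually_subset)
  then show ?thesis
    using card_le[OF forcing_closed_observed_eventually[OF finite_closed_nbhd_ladder]
        closed_nbhd_set_subset_observed_eventually S _ assms(1)] ne by blast
qed

section \<open>A failed set attaining the bound\<close>

text \<open>Alternating rows keep the facing arms \<open>(3 * i + 3, i mod 2)\<close> and
  \<open>(3 * i + 4, Suc i mod 2)\<close> of consecutive neighbourhoods non-adjacent.\<close>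

definition zigzag :: "nat \<Rightarrow> (nat \<times> nat) set" where
  "zigzag m = (\<lambda>i. (3 * i + 2, i mod 2)) ` {..<m}"

text \<open>One cross around each vertex of \<open>zigzag m\<close>. No \<open>k\<close> occurs,
  because no cross is cut off when \<open>3 * m + 2 \<le> k\<close>.\<close>

definition zigzag_nbhd :: "nat \<Rightarrow> (nat \<times> nat) set" where
  "zigzag_nbhd m =
     (\<Union>i<m. {(3 * i + 1, i mod 2), (3 * i + 2, 0), (3 * i + 2, 1), (3 * i + 3, i mod 2)})"

text \<open>The residue of the column modulo 3 tells left arm, centre and right arm apart, and the
  quotient determines the cross. Column 0 is not of any of these forms.\<close>

lemma mem_zigzag_nbhd_iff:
  "(3 * i + 1, b) \<in> zigzag_nbhd m \<longleftrightarrow> i < m \<and> b = i mod 2"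
  "(3 * i + 2, b) \<in> zigzag_nbhd m \<longleftrightarrow> i < m \<and> b < 2"
  "(3 * i + 3, b) \<in> zigzag_nbhd m \<longleftrightarrow> i < m \<and> b = i mod 2"
proof -
  have "3 * i + 1 = 3 * j + 1 \<longleftrightarrow> i = j" "3 * i + 1 \<noteq> 3 * j + 2" "3 * i + 1 \<noteq> 3 * j + 3"
    "3 * i + 2 \<noteq> 3 * j + 1" "3 * i + 2 = 3 * j + 2 \<longleftrightarrow> i = j" "3 * i + 2 \<noteq> 3 * j + 3"
    "3 * i + 3 \<noteq> 3 * j + 1" "3 * i + 3 \<noteq> 3 * j + 2" "3 * i + 3 = 3 * j + 3 \<longleftrightarrow> i = j" for j
    by presburger+
  note * = this
  show "(3 * i + 1, b) \<in> zigzag_nbhd m \<longleftrightarrow> i < m \<and> b = i mod 2"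
    "(3 * i + 2, b) \<in> zigzag_nbhd m \<longleftrightarrow> i < m \<and> b < 2"
    "(3 * i + 3, b) \<in> zigzag_nbhd m \<longleftrightarrow> i < m \<and> b = i mod 2"
    by (simp_all only: zigzag_nbhd_def UN_iff insert_iff empty_iff prod.inject * less_2_cases_iff
        lessThan_iff One_nat_def[symmetric]) blast+
qed

lemma zero_notin_zigzag_nbhd: "(0, b) \<notin> zigzag_nbhd m"
  by (simp add: zigzag_nbhd_def)

lemma card_zigzag: "card (zigzag m) = m"
  unfolding zigzag_def by (subst card_image) (auto simp: inj_on_def)

lemma closed_nbhd_zigzag:
  "closed_nbhd (ladder k) (3 * i + 2, i mod 2) \<subseteq> zigzag_nbhd m" if "i < m"
proof clarify
  fix c d assume "(c, d) \<in> closed_nbhd (ladder k) (3 * i + 2, i mod 2)"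
  then consider "c = 3 * i + 2" "d < 2" | "c = 3 * i + 1" "d = i mod 2" | "c = 3 * i + 3" "d = i mod 2"
    by (auto simp: mem_closed_nbhd_ladder_iff)
  then show "(c, d) \<in> zigzag_nbhd m"
    by cases (use that in \<open>simp_all only: mem_zigzag_nbhd_iff\<close>)
qed

lemma not_forcingI:
  assumes "x \<in> N" "y \<in> N" "x \<noteq> y" "x \<notin> T" "y \<notin> T"
  shows "\<not> N - {w} \<subseteq> T"
  using assms by auto

text \<open>A centre misses no neighbour, its rung partner misses both row neighbours, and an arm
  misses its rung neighbour and its outer row neighbour. Two missing vertices block forcing.\<close>

lemma forcing_closed_zigzag_nbhd:
  assumes "3 * m + 2 \<le> k"
  shows "forcing_closed (ladder k) (zigzag_nbhd m)"
  unfolding forcing_closed_def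
proof (intro ballI impI)
  fix v w
  assume v: "v \<in> zigzag_nbhd m" and w: "w \<in> closed_nbhd (ladder k) v"
    and sub: "closed_nbhd (ladder k) v - {w} \<subseteq> zigzag_nbhd m"
  obtain i b where i: "i < m" and b: "b < 2"
    and "v = (3 * i + 2, b) \<or> v = (3 * i + 1, i mod 2) \<or> v = (3 * i + 3, i mod 2)"
    using v unfolding zigzag_nbhd_def by fastforce
  then consider "v = (3 * i + 2, i mod 2)" | "v = (3 * i + 2, b)" "b \<noteq> i mod 2"
    | "v = (3 * i + 1, i mod 2)" | "v = (3 * i + 3, i mod 2)"
    by blast
  then show "w \<in> zigzag_nbhd m"
  proof cases
    case 1
    then show ?thesis using closed_nbhd_zigzag[OF i, of k] w by blast
  next
    case 2
    have "(3 * i + 1, b) \<notin> zigzag_nbhd m" "(3 * i + 3, b) \<notin> zigzag_nbhd m"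
      using 2 unfolding mem_zigzag_nbhd_iff by blast+
    then have "\<not> closed_nbhd (ladder k) v - {w} \<subseteq> zigzag_nbhd m"
      by (rule not_forcingI[rotated 3])
        (use 2 i b assms in \<open>auto simp: mem_closed_nbhd_ladder_iff\<close>)
    then show ?thesis using sub by blast
  next
    case 3
    \<comment> \<open>Column \<open>3 * i\<close> is column 0 or holds only the right arm of the
      previous cross, in the other row.\<close>
    have "(3 * i, i mod 2) \<notin> zigzag_nbhd m"
    proof (cases i)
      case (Suc j)
      have "Suc j mod 2 \<noteq> j mod 2" by presburger
      then show ?thesis using mem_zigzag_nbhd_iff(3)[of j] Suc by (simp add: add.commute)
    qed (simp add: zero_notin_zigzag_nbhd)
    moreover have "1 - i mod 2 \<noteq> i mod 2" by presburger
    then have "(3 * i + 1, 1 - i mod 2) \<notin> zigzag_nbhd m" unfolding mem_zigzag_nbhd_iff by blast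
    ultimately have "\<not> closed_nbhd (ladder k) v - {w} \<subseteq> zigzag_nbhd m"
      by (rule not_forcingI[rotated 3])
        (use 3 i \<open>1 - i mod 2 \<noteq> i mod 2\<close> assms in \<open>auto simp: mem_closed_nbhd_ladder_iff\<close>)
    then show ?thesis using sub by blast
  next
    case 4
    \<comment> \<open>Column \<open>3 * i + 4\<close> can contain only the left arm of the next
      cross, in the other row. For the last cross it is column \<open>3 * m + 1\<close>, which
      exists because \<open>3 * m + 2 \<le> k\<close>.\<close>
    have "Suc i mod 2 \<noteq> i mod 2" by presburger
    then have "(3 * i + 4, i mod 2) \<notin> zigzag_nbhd m"
      using mem_zigzag_nbhd_iff(1)[of "Suc i"] by (simp add: add.commute)
    moreover have "1 - i mod 2 \<noteq> i mod 2" by presburger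
    then have "(3 * i + 3, 1 - i mod 2) \<notin> zigzag_nbhd m" unfolding mem_zigzag_nbhd_iff by blast
    ultimately have "\<not> closed_nbhd (ladder k) v - {w} \<subseteq> zigzag_nbhd m"
      by (rule not_forcingI[rotated 3])
        (use 4 i \<open>1 - i mod 2 \<noteq> i mod 2\<close> assms in \<open>auto simp: mem_closed_nbhd_ladder_iff\<close>)
    then show ?thesis using sub by blast
  qed
qed

text \<open>Column 0 lies outside every cross, so \<open>(0, 0)\<close> is never observed.\<close>

lemma failed_power_dominating_zigzag:
  assumes "3 * m + 2 \<le> k"
  shows "failed_power_dominating (ladder k) (zigzag m)"
proof -
  have "observed_eventually (ladder k) (zigzag m) \<subseteq> zigzag_nbhd m"
    using closed_nbhd_zigzag[of _ m k]
    by (intro observed_eventually_subset forcing_closed_zigzag_nbhd assms)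
      (auto simp: closed_nbhd_set_def zigzag_def)
  moreover have "(0, 0) \<in> verts (ladder k)" "(0, 0) \<notin> zigzag_nbhd m"
    using assms by (auto simp: verts_ladder zero_notin_zigzag_nbhd)
  moreover have "zigzag m \<subseteq> verts (ladder k)"
    using assms by (auto simp: zigzag_def verts_ladder)
  ultimately show ?thesis
    unfolding failed_power_dominating_def power_dominating_def by blast
qed

theorem theorem7:
  fixes k :: nat
  assumes "k \<ge> 4"
  shows "int (failed_power_domination_number (cartesian_product (path_graph k) (path_graph 2)))
         = \<lceil>(real k - 4) / 3\<rceil>"
proof -
  \<comment> \<open>The largest \<open>m\<close> with \<open>3 * m + 2 \<le> k\<close>, so the
    construction meets the upper bound.\<close>
  let ?m = "(k - 2) div 3"
  have "3 * ?m + 2 \<le> k" using assms by linarith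
  then have "failed_power_domination_number (ladder k) = ?m"
    using card_failed_power_dominating_ladder_le[OF assms]
    by (intro failed_power_domination_number_eqI[OF _ failed_power_dominating_zigzag card_zigzag])
      (simp_all add: verts_ladder)
  moreover have "\<lceil>(real k - 4) / 3\<rceil> = int ?m"
  proof (rule ceiling_unique)
    have "k \<le> 3 * ?m + 4" "3 * ?m + 2 \<le> k" using assms by linarith+
    then have "real k \<le> 3 * real ?m + 4" "3 * real ?m + 2 \<le> real k" by linarith+
    then show "real_of_int (int ?m) - 1 < (real k - 4) / 3" "(real k - 4) / 3 \<le> real_of_int (int ?m)"
      by (simp_all add: field_simps)
  qed
  ultimately show ?thesis by simp
qed

end
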